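(* Let $k\ge 0$ be an integer and let $G$ be a finite $k$-regular simple graph (no loops and no multi-edges; $G$ is not assumed connected). Then $G$ has a maximum matching $M$ such that any two distinct $M$-unsaturated vertices do not share a neighbor, i.e. there are no distinct $M$-unsaturated vertices $u,v$ and vertex $w$ of $G$ with $w$ adjacent to both $u$ and $v$.
   Context: A graph is $k$-regular if every vertex has degree $k$. A matching of $G$ is a set of edges no two of which share an endvertex. A matching $M$ is maximum if $|M|\ge |M'|$ for every matching $M'$ of $G$. A vertex is $M$-saturated if it is incident with an edge of $M$, and $M$-unsaturated otherwise. *)

theory Defs
  imports Main
begin

text \<open>A graph is given by its vertex set \<open>V\<close> and its edge set \<open>E\<close>, an edge being
  the two-element set of its endvertices; this excludes loops and multi-edges.
  The empty graph is allowed.\<close>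

definition finite_simple_graph :: "'a set \<Rightarrow> 'a set set \<Rightarrow> bool" where
  "finite_simple_graph V E \<longleftrightarrow> finite V \<and> (\<forall>e\<in>E. e \<subseteq> V \<and> card e = 2)"

definition adjacent :: "'a set set \<Rightarrow> 'a \<Rightarrow> 'a \<Rightarrow> bool" where
  "adjacent E u v \<longleftrightarrow> {u, v} \<in> E"

definition degree :: "'a set set \<Rightarrow> 'a \<Rightarrow> nat" where
  "degree E v = card {e \<in> E. v \<in> e}"

definition regular :: "'a set \<Rightarrow> 'a set set \<Rightarrow> nat \<Rightarrow> bool" where
  "regular V E k \<longleftrightarrow> (\<forall>v\<in>V. degree E v = k)"

definition matching :: "'a set set \<Rightarrow> 'a set set \<Rightarrow> bool" where
  "matching E M \<longleftrightarrow> M \<subseteq> E \<and> (\<forall>e\<in>M. \<forall>f\<in>M. e \<noteq> f \<longrightarrow> e \<inter> f = {})"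

definition maximum_matching :: "'a set set \<Rightarrow> 'a set set \<Rightarrow> bool" where
  "maximum_matching E M \<longleftrightarrow> matching E M \<and> (\<forall>M'. matching E M' \<longrightarrow> card M' \<le> card M)"

definition saturated :: "'a set set \<Rightarrow> 'a \<Rightarrow> bool" where
  "saturated M v \<longleftrightarrow> (\<exists>e\<in>M. v \<in> e)"

end

theory Submission
  imports Defs
begin

text \<open>The idea is to read the unsaturated vertices off a maximal barrier: a vertex set \<open>A\<close> and a
  family \<open>P\<close> of disjoint odd sets that cover the other vertices, such that no edge joins
  two sets of \<open>P\<close>. As in the Tutte--Berge theorem, every matching leaves at least
  \<open>card P - card A\<close> vertices unsaturated. In a suitably extremal barrier, each set of \<open>P\<close> is
  perfectly matchable after the deletion of any one of its vertices, and \<open>A\<close> can be matched into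
  distinct sets of \<open>P\<close> (lemma \<open>ex_critical_barrier\<close>). Hence the bound is attained, by a matching
  with exactly one unsaturated vertex, which can be prescribed, in each set of \<open>P\<close> not matched
  to \<open>A\<close>.

  Let the graph be \<open>k\<close>-regular with \<open>k > 0\<close>, and call a set of \<open>P\<close> heavy if at least \<open>k\<close>
  edges leave it, and light otherwise. All edges that leave a set of \<open>P\<close> end in \<open>A\<close>, where each
  vertex has degree \<open>k\<close>, so double counting gives Hall's condition for matching the heavy sets
  into \<open>A\<close> (lemma \<open>large_boundaries_hall\<close>). By a two-sided version of Hall's theorem, one
  matching covers both \<open>A\<close> and all heavy sets, so that only light sets contain unsaturated
  vertices. A light set has a vertex with no neighbour outside the set (lemma
  \<open>small_boundary_inner_vertex\<close>), and this vertex is the one to leave unsaturated. Two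
  unsaturated vertices then have their neighbours in two disjoint sets.\<close>

section \<open>Hall's theorem and a two-sided version\<close>

text \<open>The induction of Halmos and Vaughan: if some proper nonempty subfamily is tight, it and the rest
  are represented separately, the rest avoiding all candidates of the tight part; if none is
  tight, any choice for one index leaves enough candidates for the others.\<close>

theorem hall_marriage:
  fixes N :: "'i \<Rightarrow> 'b set"
  assumes "finite I" and "\<forall>i\<in>I. finite (N i)"
    and "\<forall>J\<subseteq>I. card J \<le> card (\<Union>(N ` J))"
  shows "\<exists>f. inj_on f I \<and> (\<forall>i\<in>I. f i \<in> N i)"
  using assms
proof (induction "card I" arbitrary: I N rule: less_induct)
  case less
  note fin = less.prems(1) and finN = less.prems(2) and hall = less.prems(3)
  show ?case
  proof (cases "I = {}")
    case True
    then show ?thesis by simp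
  next
    case False
    show ?thesis
    proof (cases "\<exists>J. J \<subset> I \<and> J \<noteq> {} \<and> card J = card (\<Union>(N ` J))")
      case True
      then obtain J where J: "J \<subset> I" "J \<noteq> {}" "card J = card (\<Union>(N ` J))" by blast
      have finJ: "finite J" using J(1) fin finite_subset by blast
      define T where "T = \<Union>(N ` J)"
      have finT: "finite T" using finJ finN J(1) by (auto simp: T_def)
      have "\<exists>f. inj_on f J \<and> (\<forall>i\<in>J. f i \<in> N i)"
      proof (rule less.hyps)
        show "card J < card I" using J(1) fin psubset_card_mono by blast
      qed (use finJ finN hall J(1) in auto)
      then obtain f where f: "inj_on f J" "\<forall>i\<in>J. f i \<in> N i" by blast
      have "\<exists>g. inj_on g (I - J) \<and> (\<forall>i\<in>I - J. g i \<in> N i - T)"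
      proof (rule less.hyps)
        show "card (I - J) < card I"
          using J fin by (intro psubset_card_mono) auto
        show "\<forall>K\<subseteq>I - J. card K \<le> card (\<Union>i\<in>K. N i - T)"
        proof (intro allI impI)
          fix K assume K: "K \<subseteq> I - J"
          then have finK: "finite K" using fin finite_subset by blast
          have finNK: "finite (\<Union>i\<in>K. N i - T)" using finK finN K by auto
          have "card K + card J = card (K \<union> J)"
            using K finK finJ by (intro card_Un_disjoint[symmetric]) auto
          also have "\<dots> \<le> card (\<Union>(N ` (K \<union> J)))"
            using hall K J(1) by (meson DiffE psubset_imp_subset subset_eq Un_least)
          also have "\<Union>(N ` (K \<union> J)) = (\<Union>i\<in>K. N i - T) \<union> T"
            by (auto simp: T_def)
          also have "card \<dots> = card (\<Union>i\<in>K. N i - T) + card T"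
            using finNK finT by (intro card_Un_disjoint) auto
          finally show "card K \<le> card (\<Union>i\<in>K. N i - T)"
            using J(3) by (simp add: T_def)
        qed
      qed (use fin finN in auto)
      then obtain g where g: "inj_on g (I - J)" "\<forall>i\<in>I - J. g i \<in> N i - T" by blast
      have fT: "f i \<in> T" if "i \<in> J" for i using f(2) that by (auto simp: T_def)
      have "inj_on (\<lambda>i. if i \<in> J then f i else g i) I"
        using f(1) g fT unfolding inj_on_def by (metis DiffD2 DiffI)
      then show ?thesis using f(2) g(2) by (intro exI[of _ "\<lambda>i. if i \<in> J then f i else g i"]) auto
    next
      case no_tight: False
      obtain i where i: "i \<in> I" using False by blast
      have "card {i} \<le> card (\<Union>(N ` {i}))" using hall i by blast
      then have "N i \<noteq> {}" by auto
      then obtain x where x: "x \<in> N i" by blast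
      have "\<exists>f. inj_on f (I - {i}) \<and> (\<forall>j\<in>I - {i}. f j \<in> N j - {x})"
      proof (rule less.hyps)
        show "card (I - {i}) < card I" using i fin by (rule card_Diff1_less[rotated])
        show "\<forall>K\<subseteq>I - {i}. card K \<le> card (\<Union>j\<in>K. N j - {x})"
        proof (intro allI impI)
          fix K assume K: "K \<subseteq> I - {i}"
          have eq: "(\<Union>j\<in>K. N j - {x}) = \<Union>(N ` K) - {x}" by auto
          show "card K \<le> card (\<Union>j\<in>K. N j - {x})"
          proof (cases "K = {}")
            case False
            have "K \<subset> I" using K i by auto
            then have "card K \<noteq> card (\<Union>(N ` K))" "card K \<le> card (\<Union>(N ` K))"
              using no_tight False hall by auto
            then show ?thesis unfolding eq using card_Diff1_le[of "\<Union>(N ` K)" x]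
              by (cases "x \<in> \<Union>(N ` K)") (auto simp: card_Diff_singleton_if)
          qed simp
        qed
      qed (use fin finN in auto)
      then obtain f where f: "inj_on f (I - {i})" "\<forall>j\<in>I - {i}. f j \<in> N j - {x}" by blast
      have "inj_on (f(i := x)) I"
        using f unfolding inj_on_def by (auto simp: fun_upd_def)
      then show ?thesis using f(2) x by (intro exI[of _ "f(i := x)"]) auto
    qed
  qed
qed

text \<open>One Hall condition lets all of \<open>A\<close> be matched into \<open>P\<close>, the other lets \<open>H\<close> be matched into
  \<open>A\<close>; both can be achieved by one matching. The trick is to add \<open>card P - card A\<close> dummy partners,
  available exactly to the elements outside \<open>H\<close>. A system of distinct representatives for \<open>P\<close>
  then uses up every partner by counting, so it covers \<open>A\<close>, and \<open>H\<close> only has real partners.\<close>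

lemma two_sided_hall:
  fixes R :: "'p \<Rightarrow> 'a \<Rightarrow> bool"
  assumes finP: "finite P" and finA: "finite A" and HP: "H \<subseteq> P"
    and hallH: "\<forall>J\<subseteq>H. card J \<le> card {a\<in>A. \<exists>X\<in>J. R X a}"
    and hallA: "\<forall>B\<subseteq>A. card B \<le> card {X\<in>P. \<exists>a\<in>B. R X a}"
  shows "\<exists>g. inj_on g A \<and> g ` A \<subseteq> P \<and> H \<subseteq> g ` A \<and> (\<forall>a\<in>A. R (g a) a)"
proof -
  define d where "d = card P - card A"
  have "card A \<le> card {X\<in>P. \<exists>a\<in>A. R X a}" using hallA by blast
  also have "\<dots> \<le> card P" using finP by (intro card_mono) auto
  finally have d: "card P = card A + d" by (simp add: d_def)
  define D where "D = (Inr ` {..<d} :: ('a + nat) set)"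
  have cardD: "card D = d" by (simp add: D_def card_image)
  have finD: "finite D" by (simp add: D_def)
  define N where "N X = Inl ` {a\<in>A. R X a} \<union> (if X \<in> H then {} else D)" for X
  have finN: "finite (N X)" for X using finA finD by (simp add: N_def)
  have "\<exists>f. inj_on f P \<and> (\<forall>X\<in>P. f X \<in> N X)"
  proof (rule hall_marriage)
    show "\<forall>J\<subseteq>P. card J \<le> card (\<Union>(N ` J))"
    proof (intro allI impI)
      fix J assume J: "J \<subseteq> P"
      have finJ: "finite J" using J finP finite_subset by blast
      let ?NA = "{a\<in>A. \<exists>X\<in>J. R X a}"
      have card_Inl: "card (Inl ` ?NA :: ('a + nat) set) = card ?NA"
        by (simp add: card_image)
      show "card J \<le> card (\<Union>(N ` J))"
      proof (cases "J \<subseteq> H")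
        case True
        then have "\<Union>(N ` J) = Inl ` ?NA" by (auto simp: N_def)
        then show ?thesis using hallH True card_Inl by auto
      next
        case False
        then have "\<Union>(N ` J) = Inl ` ?NA \<union> D" by (auto simp: N_def split: if_splits)
        also have "card \<dots> = card ?NA + d"
          using finA finD cardD card_Inl by (subst card_Un_disjoint) (auto simp: D_def)
        finally have eq: "card (\<Union>(N ` J)) = card ?NA + d" .
        let ?B = "A - ?NA"
        have "card ?B \<le> card {X\<in>P. \<exists>a\<in>?B. R X a}" using hallA by blast
        also have "\<dots> \<le> card (P - J)" using finP by (intro card_mono) auto
        also have "\<dots> = card P - card J" using J finJ by (simp add: card_Diff_subset)
        finally have "card A - card ?NA \<le> card P - card J"
          using finA by (simp add: card_Diff_subset)
        moreover have "card J \<le> card P" "card ?NA \<le> card A"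
          using J finP finA by (auto intro!: card_mono)
        ultimately show ?thesis using eq d by linarith
      qed
    qed
  qed (use finP finN in auto)
  then obtain f where f: "inj_on f P" "\<forall>X\<in>P. f X \<in> N X" by blast
  have "f ` P = Inl ` A \<union> D"
  proof (rule card_subset_eq)
    show "finite (Inl ` A \<union> D)" using finA finD by simp
    show "f ` P \<subseteq> Inl ` A \<union> D" using f(2) by (auto simp: N_def split: if_splits)
    have "card (Inl ` A \<union> D) = card A + d"
      using finA finD cardD by (subst card_Un_disjoint) (auto simp: D_def card_image)
    then show "card (f ` P) = card (Inl ` A \<union> D)" using f(1) d by (simp add: card_image)
  qed
  then have "\<forall>a\<in>A. \<exists>X\<in>P. f X = Inl a" by (metis UnI1 imageE imageI)
  then obtain g where g: "\<forall>a\<in>A. g a \<in> P \<and> f (g a) = Inl a" by metis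
  have "inj_on g A" using g unfolding inj_on_def by (metis Inl_inject)
  moreover have "H \<subseteq> g ` A"
  proof
    fix X assume X: "X \<in> H"
    then have "f X \<in> Inl ` {a\<in>A. R X a}" using f(2) HP by (auto simp: N_def)
    then obtain a where a: "a \<in> A" "f X = Inl a" by auto
    then have "g a = X" using g f(1) X HP by (metis inj_onD subsetD)
    then show "X \<in> g ` A" using a by auto
  qed
  moreover have "R (g a) a" if "a \<in> A" for a
  proof -
    have "Inl a \<in> N (g a)" using g f(2) that by metis
    then show ?thesis by (auto simp: N_def D_def split: if_splits)
  qed
  ultimately show ?thesis using g by (intro exI[of _ g]) auto
qed


section \<open>Matchings and barriers\<close>

lemma card_2_eq_pair:
  assumes "card e = 2" and "a \<in> e" and "b \<in> e" and "a \<noteq> b"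
  shows "e = {a, b}"
  using assms by (auto simp: card_2_iff)

lemma card_Union_matching:
  assumes "\<forall>e\<in>E. card e = 2" and "matching E M"
  shows "card (\<Union>M) = 2 * card M"
proof -
  have c: "\<forall>e\<in>M. card e = 2" using assms by (auto simp: matching_def)
  have "card (\<Union>M) = sum card M"
    using assms(2) c by (intro card_Union_disjoint)
      (auto simp: pairwise_def disjnt_def matching_def intro!: card_ge_0_finite)
  then show ?thesis using c by simp
qed

lemma matching_UN:
  assumes "\<forall>i\<in>I. matching E (M i)"
    and "\<forall>i\<in>I. \<forall>j\<in>I. i \<noteq> j \<longrightarrow> \<Union>(M i) \<inter> \<Union>(M j) = {}"
  shows "matching E (\<Union>i\<in>I. M i)"
  unfolding matching_def
proof (intro conjI ballI impI)
  show "(\<Union>i\<in>I. M i) \<subseteq> E" using assms(1) by (auto simp: matching_def)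
  fix e f assume ef: "e \<in> (\<Union>i\<in>I. M i)" "f \<in> (\<Union>i\<in>I. M i)" "e \<noteq> f"
  then obtain i j where ij: "i \<in> I" "j \<in> I" "e \<in> M i" "f \<in> M j" by blast
  show "e \<inter> f = {}"
  proof (cases "i = j")
    case True
    then show ?thesis using assms(1) ij ef(3) by (auto simp: matching_def)
  next
    case False
    then have "\<Union>(M i) \<inter> \<Union>(M j) = {}" using assms(2) ij by blast
    then show ?thesis using ij by blast
  qed
qed

text \<open>This replaces the odd components of the subgraph induced on \<open>W - A\<close> by any family of
  disjoint odd unions of components. The maximum of \<open>card P - card A\<close> is the same, and
  connectedness never has to be discussed.\<close>

definition barrier :: "'a set set \<Rightarrow> 'a set \<Rightarrow> 'a set \<Rightarrow> 'a set set \<Rightarrow> bool" where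
  "barrier E W A P \<longleftrightarrow> A \<subseteq> W \<and> pairwise disjnt P \<and>
    (\<forall>X\<in>P. X \<subseteq> W - A \<and> odd (card X) \<and>
      (\<forall>e\<in>E. e \<subseteq> W \<longrightarrow> e \<inter> X \<noteq> {} \<longrightarrow> e \<subseteq> X \<union> A))"

text \<open>This is the part of the Gallai--Edmonds structure that is needed: the third condition is
  factor-criticality of the sets in \<open>P\<close>, the last one is Hall's condition for matching \<open>A\<close> into
  distinct sets of \<open>P\<close>.\<close>

definition critical_barrier :: "'a set set \<Rightarrow> 'a set \<Rightarrow> 'a set \<Rightarrow> 'a set set \<Rightarrow> bool" where
  "critical_barrier E W A P \<longleftrightarrow> barrier E W A P \<and> A \<union> \<Union>P = W \<and>
    (\<forall>X\<in>P. \<forall>v\<in>X. \<exists>N. matching E N \<and> \<Union>N = X - {v}) \<and>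
    (\<forall>B\<subseteq>A. card B \<le> card {X\<in>P. \<exists>a\<in>B. \<exists>x\<in>X. {a, x} \<in> E})"

lemma
  assumes "barrier E W A P" and "X \<in> P"
  shows barrier_subset: "X \<subseteq> W - A"
    and barrier_odd: "odd (card X)"
    and barrier_closed: "e \<in> E \<Longrightarrow> e \<subseteq> W \<Longrightarrow> e \<inter> X \<noteq> {} \<Longrightarrow> e \<subseteq> X \<union> A"
    and barrier_disjoint: "Y \<in> P \<Longrightarrow> x \<in> X \<Longrightarrow> x \<in> Y \<Longrightarrow> X = Y"
  using assms by (auto simp: barrier_def pairwise_def disjnt_def)

lemma barrier_finite:
  assumes "finite W" and "barrier E W A P"
  shows "finite A" and "finite P" and "\<And>X. X \<in> P \<Longrightarrow> finite X \<and> X \<noteq> {}"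
proof -
  show "finite A" using assms finite_subset by (auto simp: barrier_def)
  have "P \<subseteq> Pow W" using assms by (auto simp: barrier_def)
  then show "finite P" using assms(1) finite_subset by blast
  fix X assume X: "X \<in> P"
  then have "odd (card X)" using assms by (auto simp: barrier_def)
  then show "finite X \<and> X \<noteq> {}" by (metis card.empty card.infinite even_zero)
qed

text \<open>The easy half of the Tutte--Berge formula: an odd set of the family cannot be perfectly
  matched within itself, so it contains an unsaturated vertex or sends a matching edge to \<open>A\<close>.
  These witnesses are distinct for distinct sets.\<close>

lemma barrier_bound:
  assumes two: "\<forall>e\<in>E. card e = 2" and fin: "finite W"
    and bar: "barrier E W A P" and M: "matching E M" "\<Union>M \<subseteq> W"
  shows "card P \<le> card A + card (W - \<Union>M)"
proof -
  note finP = barrier_finite[OF fin bar]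
  have disj: "X = Y" if "X \<in> P" "Y \<in> P" "x \<in> X" "x \<in> Y" for X Y x
    using barrier_disjoint[OF bar] that by blast
  have wit: "\<exists>y. y \<in> A \<union> (W - \<Union>M) \<and>
      (y \<in> X \<or> (y \<in> A \<and> (\<exists>x\<in>X. {x, y} \<in> M)))" if X: "X \<in> P" for X
  proof (rule ccontr)
    assume none: "\<not> ?thesis"
    have XW: "X \<subseteq> W - A" "odd (card X)" using bar X by (auto simp: barrier_def)
    then have sat: "X \<subseteq> \<Union>M" using none by auto
    define L where "L = {e\<in>M. e \<inter> X \<noteq> {}}"
    have "e \<subseteq> X" if e: "e \<in> L" for e
    proof
      fix y assume y: "y \<in> e"
      obtain x where x: "x \<in> e" "x \<in> X" using e by (auto simp: L_def)
      have eM: "e \<in> M" using e by (simp add: L_def)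
      then have eE: "e \<in> E" and eW: "e \<subseteq> W" using M by (auto simp: matching_def)
      have sub: "e \<subseteq> X \<union> A" using barrier_closed[OF bar X eE eW] x by blast
      show "y \<in> X"
      proof (rule ccontr)
        assume yX: "y \<notin> X"
        then have yA: "y \<in> A" using sub y by blast
        have "x \<noteq> y" using x yX by blast
        then have "e = {x, y}" using two eE x y
          by (intro card_2_eq_pair) auto
        then show False using none yA x eM by blast
      qed
    qed
    then have "\<Union>L \<subseteq> X" by blast
    moreover have "X \<subseteq> \<Union>L" using sat unfolding L_def by blast
    ultimately have "\<Union>L = X" by blast
    moreover have "matching E L" using M(1) by (auto simp: matching_def L_def)
    ultimately have "card X = 2 * card L" using card_Union_matching[OF two] by metis
    then show False using XW by simp
  qed
  then obtain h where h: "\<forall>X\<in>P. h X \<in> A \<union> (W - \<Union>M) \<and>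
      (h X \<in> X \<or> (h X \<in> A \<and> (\<exists>x\<in>X. {x, h X} \<in> M)))" by metis
  have "inj_on h P"
  proof (rule inj_onI)
    fix X Y assume XY: "X \<in> P" "Y \<in> P" "h X = h Y"
    show "X = Y"
    proof (cases "h X \<in> A")
      case True
      have "X \<subseteq> W - A" "Y \<subseteq> W - A" using bar XY by (auto simp: barrier_def)
      then obtain x y where xy: "x \<in> X" "{x, h X} \<in> M" "y \<in> Y" "{y, h X} \<in> M"
        using h XY True by (metis DiffD2 subsetD)
      have "{x, h X} \<inter> {y, h X} \<noteq> {}" by simp
      then have "{x, h X} = {y, h X}" using M(1) xy(2,4) unfolding matching_def by metis
      then have "x = y" by (metis doubleton_eq_iff)
      then show ?thesis using disj XY xy by blast
    next
      case False
      then have "h X \<in> X" using h XY(1) by metis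
      moreover have "h X \<in> Y" using False h XY(2,3) by metis
      ultimately show ?thesis using disj XY by blast
    qed
  qed
  then have "card P = card (h ` P)" by (simp add: card_image)
  also have "\<dots> \<le> card (A \<union> (W - \<Union>M))"
    using h fin finP by (intro card_mono) auto
  also have "\<dots> \<le> card A + card (W - \<Union>M)" by (rule card_Un_le)
  finally show ?thesis .
qed

text \<open>The flexibility that a critical barrier offers: a set of the family that is joined to \<open>A\<close>
  loses the endvertex of the joining edge, any other set loses a vertex \<open>c X\<close> of free choice, and
  what is left of each set is perfectly matchable. Moreover, any subfamily \<open>H\<close> satisfying Hall's
  condition into \<open>A\<close> can be kept free of unsaturated vertices.\<close>

lemma critical_barrier_matching:
  assumes fin: "finite W" and crit: "critical_barrier E W A P"
    and HP: "H \<subseteq> P" and hallH: "\<forall>J\<subseteq>H. card J \<le> card {a\<in>A. \<exists>X\<in>J. \<exists>x\<in>X. {a, x} \<in> E}"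
    and c: "\<forall>X\<in>P. c X \<in> X"
  shows "\<exists>M Q. matching E M \<and> \<Union>M \<subseteq> W \<and> W - \<Union>M = c ` Q \<and> Q \<subseteq> P - H \<and>
    card (W - \<Union>M) + card A = card P"
proof -
  have bar: "barrier E W A P" and cover: "A \<union> \<Union>P = W"
    and fc: "\<forall>X\<in>P. \<forall>v\<in>X. \<exists>N. matching E N \<and> \<Union>N = X - {v}"
    and hallA: "\<forall>B\<subseteq>A. card B \<le> card {X\<in>P. \<exists>a\<in>B. \<exists>x\<in>X. {a, x} \<in> E}"
    using crit by (auto simp: critical_barrier_def)
  note finP = barrier_finite[OF fin bar]
  have disj: "X = Y" if "X \<in> P" "Y \<in> P" "x \<in> X" "x \<in> Y" for X Y x
    using barrier_disjoint[OF bar] that by blast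
  have XA: "x \<notin> A" if "X \<in> P" "x \<in> X" for X x
    using bar that by (auto simp: barrier_def)
  obtain g where g: "inj_on g A" "g ` A \<subseteq> P" "H \<subseteq> g ` A" "\<forall>a\<in>A. \<exists>x\<in>g a. {a, x} \<in> E"
    using two_sided_hall[OF finP(2) finP(1) HP hallH hallA] by blast
  have "\<forall>X\<in>P. \<exists>r\<in>X. (\<forall>a\<in>A. g a = X \<longrightarrow> {a, r} \<in> E) \<and> (X \<notin> g ` A \<longrightarrow> r = c X)"
  proof
    fix X assume X: "X \<in> P"
    show "\<exists>r\<in>X. (\<forall>a\<in>A. g a = X \<longrightarrow> {a, r} \<in> E) \<and> (X \<notin> g ` A \<longrightarrow> r = c X)"
    proof (cases "X \<in> g ` A")
      case True
      then obtain a where a: "a \<in> A" "g a = X" by auto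
      then obtain x where "x \<in> X" "{a, x} \<in> E" using g(4) by auto
      then show ?thesis using True a g(1) by (metis inj_onD)
    next
      case False
      then show ?thesis using c X by auto
    qed
  qed
  then obtain r where r: "\<forall>X\<in>P. r X \<in> X"
    "\<forall>a\<in>A. {a, r (g a)} \<in> E" "\<forall>X\<in>P. X \<notin> g ` A \<longrightarrow> r X = c X"
    using g(2) by (metis imageI subsetD)
  have "\<forall>X\<in>P. \<exists>N. matching E N \<and> \<Union>N = X - {r X}" using fc r(1) by blast
  then obtain N where N: "\<forall>X\<in>P. matching E (N X) \<and> \<Union>(N X) = X - {r X}"
    using bchoice[of P "\<lambda>X N. matching E N \<and> \<Union>N = X - {r X}"] by blast
  \<comment> \<open>One matching per set of the family: the inner matching and the edge to \<open>A\<close>, if any.\<close>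
  define K where "K X = N X \<union> (\<lambda>a. {a, r X}) ` {a\<in>A. g a = X}" for X
  have K_verts: "\<Union>(K X) = X - {r X} \<union> {a\<in>A. g a = X} \<union> (if X \<in> g ` A then {r X} else {})"
    if "X \<in> P" for X using N that by (auto simp: K_def)
  have K_matching: "matching E (K X)" if X: "X \<in> P" for X
  proof -
    have NX: "N X \<subseteq> E" "\<forall>e\<in>N X. \<forall>f\<in>N X. e \<noteq> f \<longrightarrow> e \<inter> f = {}"
      using N X by (auto simp: matching_def)
    have cross: "e \<inter> {a, r X} = {}" if "e \<in> N X" "a \<in> A" for e a
    proof -
      have "e \<subseteq> X - {r X}" using N X that(1) by blast
      then show ?thesis using XA[OF X] that(2) by blast
    qed
    have one: "a = b" if "a \<in> A" "b \<in> A" "g a = X" "g b = X" for a b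
      using g(1) that by (metis inj_onD)
    show ?thesis unfolding matching_def
    proof (intro conjI ballI impI)
      show "K X \<subseteq> E" using NX(1) r(2) by (auto simp: K_def)
      fix e f assume "e \<in> K X" "f \<in> K X" and ne: "e \<noteq> f"
      then consider "e \<in> N X" "f \<in> N X"
        | a where "e \<in> N X" "a \<in> A" "f = {a, r X}"
        | a where "f \<in> N X" "a \<in> A" "e = {a, r X}"
        | a b where "a \<in> A" "b \<in> A" "g a = X" "g b = X" "e = {a, r X}" "f = {b, r X}"
        unfolding K_def by blast
      then show "e \<inter> f = {}"
      proof cases
        case 1
        then show ?thesis using NX(2) ne by blast
      next
        case 2
        then show ?thesis using cross by blast
      next
        case 3
        then show ?thesis using cross by blast
      next
        case 4
        then have "e = f" using one by blast
        then show ?thesis using ne by blast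
      qed
    qed
  qed
  define M where "M = (\<Union>X\<in>P. K X)"
  have "matching E M" unfolding M_def
  proof (rule matching_UN)
    show "\<forall>X\<in>P. matching E (K X)" using K_matching by blast
    show "\<forall>X\<in>P. \<forall>Y\<in>P. X \<noteq> Y \<longrightarrow> \<Union>(K X) \<inter> \<Union>(K Y) = {}"
    proof (intro ballI impI)
      fix X Y assume XY: "X \<in> P" "Y \<in> P" "X \<noteq> Y"
      have "\<Union>(K Z) \<subseteq> Z \<union> {a\<in>A. g a = Z}" if "Z \<in> P" for Z
        using K_verts[OF that] r(1) that by auto
      then show "\<Union>(K X) \<inter> \<Union>(K Y) = {}"
        using XY disj XA by blast
    qed
  qed
  moreover have UM: "\<Union>M = W - c ` (P - g ` A)"
  proof -
    define C where "C = c ` (P - g ` A)"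
    have "\<Union>(K X) = {a\<in>A. g a = X} \<union> (X - C)" if X: "X \<in> P" for X
    proof (cases "X \<in> g ` A")
      case True
      have "x \<notin> C" if "x \<in> X" for x
      proof
        assume "x \<in> C"
        then obtain Y where "Y \<in> P" "Y \<notin> g ` A" "x = c Y" by (auto simp: C_def)
        then show False using c disj[OF X, of Y x] that True by metis
      qed
      then have "X - C = X" by blast
      then show ?thesis using K_verts[OF X] True r(1) X by auto
    next
      case False
      have "x \<in> C \<longleftrightarrow> x = c X" if "x \<in> X" for x
      proof
        assume "x \<in> C"
        then obtain Y where "Y \<in> P" "x = c Y" by (auto simp: C_def)
        then show "x = c X" using c disj[OF X, of Y x] that by metis
      qed (use False X in \<open>auto simp: C_def\<close>)
      then have "X - C = X - {c X}" by blast
      moreover have "r X = c X" using r(3) False X by blast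
      ultimately show ?thesis using K_verts[OF X] False by auto
    qed
    moreover have "\<Union>M = (\<Union>X\<in>P. \<Union>(K X))" by (auto simp: M_def)
    ultimately have "\<Union>M = (\<Union>X\<in>P. {a\<in>A. g a = X} \<union> (X - C))" by simp
    also have "\<dots> = A \<union> (\<Union>P - C)" using g(2) by blast
    also have "\<dots> = A \<union> \<Union>P - C"
    proof -
      have "A \<inter> C = {}" using c XA by (auto simp: C_def)
      then show ?thesis by blast
    qed
    also have "\<dots> = W - c ` (P - g ` A)" using cover by (simp add: C_def)
    finally show ?thesis .
  qed
  moreover have cW: "c ` (P - g ` A) \<subseteq> W" using c cover by auto
  moreover have "card (W - \<Union>M) + card A = card P"
  proof -
    have "inj_on c P" using c disj by (metis inj_onI)
    then have "card (c ` (P - g ` A)) = card (P - g ` A)"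
      by (meson Diff_subset card_image inj_on_subset)
    also have "\<dots> = card P - card A"
      using g(1,2) finP by (simp add: card_Diff_subset card_image)
    moreover have "card A \<le> card P" using g finP by (metis card_image card_mono)
    moreover have "W - \<Union>M = c ` (P - g ` A)" using UM cW by blast
    ultimately show ?thesis by simp
  qed
  moreover have "\<Union>M \<subseteq> W" "W - \<Union>M = c ` (P - g ` A)" using UM cW by blast+
  moreover have "P - g ` A \<subseteq> P - H" using g(3) by blast
  ultimately show ?thesis by metis
qed

lemma finite_ex_maximum:
  fixes f :: "'b \<Rightarrow> int"
  assumes "finite S" and "S \<noteq> {}"
  shows "\<exists>x\<in>S. \<forall>y\<in>S. f y \<le> f x"
proof -
  have "Max (f ` S) \<in> f ` S" using assms by (intro Max_in) auto
  then obtain x where "x \<in> S" "f x = Max (f ` S)" by auto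
  moreover have "f y \<le> Max (f ` S)" if "y \<in> S" for y using assms(1) that by simp
  ultimately show ?thesis by metis
qed

text \<open>Choose a barrier with \<open>card P - card A\<close> maximum and, among these, with \<open>A\<close> as large as
  possible. A violation of any property of a critical barrier yields a barrier that is better
  in this order. For criticality of a set \<open>X\<close>, the vertex set \<open>X - {v}\<close> is smaller than \<open>W\<close>, so by
  induction it has a critical barrier \<open>(T, Q)\<close> of its own; if \<open>X - {v}\<close> is not perfectly matchable,
  then \<open>card T + 2 \<le> card Q\<close> by parity, which pays for moving \<open>v\<close> and \<open>T\<close> into \<open>A\<close> and for
  replacing \<open>X\<close> by the sets in \<open>Q\<close>.\<close>

lemma ex_critical_barrier:
  assumes "\<forall>e\<in>E. card e = 2" and "finite W"
  shows "\<exists>A P. critical_barrier E W A P"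
  using assms(2)
proof (induction "card W" arbitrary: W rule: less_induct)
  case less
  note fin = less.prems and two = assms(1)
  define S where "S = {(A, P). barrier E W A P}"
  have "S \<subseteq> Pow W \<times> Pow (Pow W)" by (auto simp: S_def barrier_def)
  then have finS: "finite S" by (rule finite_subset) (simp add: fin)
  have "({}, {}) \<in> S" by (simp add: S_def barrier_def)
  then have "S \<noteq> {}" by blast
  then obtain p where p: "p \<in> S" "\<forall>q\<in>S. int (card (snd q)) - int (card (fst q))
      \<le> int (card (snd p)) - int (card (fst p))"
    using finite_ex_maximum[OF finS, of "\<lambda>q. int (card (snd q)) - int (card (fst q))"] by blast
  define S' where "S' = {q\<in>S. int (card (snd q)) - int (card (fst q))
      = int (card (snd p)) - int (card (fst p))}"
  have "p \<in> S'" using p(1) by (simp add: S'_def)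
  then have "S' \<noteq> {}" by blast
  moreover have "finite S'" using finS by (simp add: S'_def)
  ultimately obtain q where q: "q \<in> S'" "\<forall>q'\<in>S'. int (card (fst q')) \<le> int (card (fst q))"
    using finite_ex_maximum[of S' "\<lambda>q. int (card (fst q))"] by blast
  obtain A P where AP: "q = (A, P)" by fastforce
  have bar: "barrier E W A P" using q AP by (auto simp: S'_def S_def)
  have max_excess: "int (card P') - int (card A') \<le> int (card P) - int (card A)"
    if "barrier E W A' P'" for A' P'
    using p(2) q(1) AP that by (auto simp: S'_def S_def)
  have max_A: "card A' \<le> card A" if "barrier E W A' P'"
    "int (card P') - int (card A') = int (card P) - int (card A)" for A' P'
  proof -
    have "(A', P') \<in> S'" using that q(1) AP by (auto simp: S'_def S_def)
    then show ?thesis using q(2) AP by fastforce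
  qed
  have no_better: False if "barrier E W A' P'" "card A < card A'"
    "card P + card A' \<le> card P' + card A" for A' P'
    using max_excess[OF that(1)] max_A[OF that(1)] that(2,3) by linarith
  note finP = barrier_finite[OF fin bar]
  have AW: "A \<subseteq> W" using bar by (simp add: barrier_def)
  have PW: "\<And>X. X \<in> P \<Longrightarrow> X \<subseteq> W - A" and Podd: "\<And>X. X \<in> P \<Longrightarrow> odd (card X)"
    and closed: "\<And>X e. X \<in> P \<Longrightarrow> e \<in> E \<Longrightarrow> e \<subseteq> W \<Longrightarrow> e \<inter> X \<noteq> {} \<Longrightarrow> e \<subseteq> X \<union> A"
    using barrier_subset[OF bar] barrier_odd[OF bar] barrier_closed[OF bar] by simp_all
  have disj: "X = Y" if "X \<in> P" "Y \<in> P" "x \<in> X" "x \<in> Y" for X Y x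
    using barrier_disjoint[OF bar] that by blast
  have cover: "A \<union> \<Union>P = W"
  proof (rule ccontr)
    assume ne: "A \<union> \<Union>P \<noteq> W"
    define R where "R = W - A - \<Union>P"
    have R: "R \<noteq> {}" "finite R" using ne AW PW fin by (auto simp: R_def)
    have Rclosed: "e \<subseteq> R \<union> A" if e: "e \<in> E" "e \<subseteq> W" "e \<inter> R \<noteq> {}" for e
    proof
      fix y assume y: "y \<in> e"
      show "y \<in> R \<union> A"
      proof (rule ccontr)
        assume "y \<notin> R \<union> A"
        then obtain X where X: "X \<in> P" "y \<in> X" using y e by (auto simp: R_def)
        then have "e \<subseteq> X \<union> A" using closed e y by blast
        then show False using e(3) X by (auto simp: R_def)
      qed
    qed
    have RP: "R \<notin> P" using R by (auto simp: R_def)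
    show False
    proof (cases "odd (card R)")
      case True
      have "barrier E W A (insert R P)"
        unfolding barrier_def
      proof (intro conjI)
        show "pairwise disjnt (insert R P)"
          using bar by (auto simp: barrier_def pairwise_insert disjnt_def R_def)
        show "\<forall>X\<in>insert R P. X \<subseteq> W - A \<and> odd (card X) \<and>
            (\<forall>e\<in>E. e \<subseteq> W \<longrightarrow> e \<inter> X \<noteq> {} \<longrightarrow> e \<subseteq> X \<union> A)"
        proof
          fix X assume "X \<in> insert R P"
          then consider "X = R" | "X \<in> P" by blast
          then show "X \<subseteq> W - A \<and> odd (card X) \<and>
            (\<forall>e\<in>E. e \<subseteq> W \<longrightarrow> e \<inter> X \<noteq> {} \<longrightarrow> e \<subseteq> X \<union> A)"
          proof cases
            case 1
            have "R \<subseteq> W - A" by (auto simp: R_def)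
            then show ?thesis using 1 True Rclosed by simp
          next
            case 2
            then show ?thesis using PW Podd closed by simp
          qed
        qed
      qed (rule AW)
      from max_excess[OF this] show False using RP finP by simp
    next
      case False
      obtain v where v: "v \<in> R" using R by blast
      define R' where "R' = R - {v}"
      have odd': "odd (card R')" using False R v
        by (metis R'_def card_Suc_Diff1 even_Suc)
      have R'P: "R' \<notin> P"
      proof
        assume "R' \<in> P"
        then have "R' \<noteq> {}" "R' \<subseteq> \<Union>P" using finP(3) by auto
        then show False by (auto simp: R'_def R_def)
      qed
      have "barrier E W (insert v A) (insert R' P)"
        unfolding barrier_def
      proof (intro conjI)
        show "insert v A \<subseteq> W" using AW v by (auto simp: R_def)
        show "pairwise disjnt (insert R' P)"
          using bar by (auto simp: barrier_def pairwise_insert disjnt_def R_def R'_def)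
        show "\<forall>X\<in>insert R' P. X \<subseteq> W - insert v A \<and> odd (card X) \<and>
            (\<forall>e\<in>E. e \<subseteq> W \<longrightarrow> e \<inter> X \<noteq> {} \<longrightarrow> e \<subseteq> X \<union> insert v A)"
        proof
          fix X assume "X \<in> insert R' P"
          then consider "X = R'" | "X \<in> P" by blast
          then show "X \<subseteq> W - insert v A \<and> odd (card X) \<and>
            (\<forall>e\<in>E. e \<subseteq> W \<longrightarrow> e \<inter> X \<noteq> {} \<longrightarrow> e \<subseteq> X \<union> insert v A)"
          proof cases
            case 1
            have "e \<subseteq> R' \<union> insert v A" if "e \<in> E" "e \<subseteq> W" "e \<inter> R' \<noteq> {}" for e
              using Rclosed[of e] that by (auto simp: R'_def)
            then show ?thesis using 1 odd' by (auto simp: R'_def R_def)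
          next
            case 2
            have "v \<notin> X" using 2 v by (auto simp: R_def)
            have "X \<subseteq> W - insert v A" using PW[OF 2] \<open>v \<notin> X\<close> by blast
            moreover have "e \<subseteq> X \<union> insert v A" if "e \<in> E" "e \<subseteq> W" "e \<inter> X \<noteq> {}" for e
              using closed[OF 2 that] by blast
            ultimately show ?thesis using Podd[OF 2] by blast
          qed
        qed
      qed
      moreover have "v \<notin> A" using v by (auto simp: R_def)
      ultimately show False
        using no_better[of "insert v A" "insert R' P"] R'P finP by simp
    qed
  qed
  have "\<exists>N. matching E N \<and> \<Union>N = X - {v}" if X: "X \<in> P" and v: "v \<in> X" for X v
  proof (rule ccontr)
    assume no_pm: "\<not> ?thesis"
    define Y where "Y = X - {v}"
    have finX: "finite X" using finP(3) X by blast
    have finY: "finite Y" using finX by (simp add: Y_def)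
    have "card Y < card X" using finX v unfolding Y_def by (rule card_Diff1_less)
    also have "\<dots> \<le> card W" using PW[OF X] fin by (intro card_mono) auto
    finally obtain T Q where TQ: "critical_barrier E Y T Q" using less.hyps finY by blast
    then have barQ: "barrier E Y T Q" by (simp add: critical_barrier_def)
    note finQ = barrier_finite[OF finY barQ]
    obtain c where "\<forall>Z\<in>Q. c Z \<in> Z" using finQ(3) by (metis ex_in_conv)
    from critical_barrier_matching[OF finY TQ empty_subsetI _ this]
    obtain N where N: "matching E N" "\<Union>N \<subseteq> Y" "card (Y - \<Union>N) + card T = card Q" by auto
    have "\<Union>N \<noteq> Y" using no_pm N(1) by (auto simp: Y_def)
    then have "card (Y - \<Union>N) \<noteq> 0" using N(2) finY by auto
    moreover have "even (card (Y - \<Union>N))"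
    proof -
      have "even (card Y)" using Podd[OF X] finX v by (simp add: Y_def card_Diff_singleton)
      moreover have "finite (\<Union>N)" using N(2) finY finite_subset by blast
      ultimately show ?thesis using card_Union_matching[OF two N(1)] N(2)
        by (simp add: card_Diff_subset)
    qed
    ultimately have "2 \<le> card (Y - \<Union>N)" by presburger
    then have excess: "card T + 2 \<le> card Q" using N(3) by linarith
    have TY: "T \<subseteq> Y" and QY: "\<And>Z. Z \<in> Q \<Longrightarrow> Z \<subseteq> Y - T"
      using barQ by (auto simp: barrier_def)
    have XW: "X \<subseteq> W - A" by (rule PW[OF X])
    define A' where "A' = A \<union> insert v T"
    define P' where "P' = (P - {X}) \<union> Q"
    have "barrier E W A' P'"
      unfolding barrier_def
    proof (intro conjI)
      show "A' \<subseteq> W" using AW TY XW v by (auto simp: A'_def Y_def)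
      show "pairwise disjnt P'"
      proof -
        have cross: "Z \<inter> Z' = {}" if "Z \<in> P - {X}" "Z' \<in> Q" for Z Z'
          using that QY[of Z'] disj[of Z X] X by (auto simp: Y_def)
        have inside: "pairwise disjnt (P - {X})" "pairwise disjnt Q"
          using bar barQ by (auto simp: barrier_def pairwise_def)
        show ?thesis
        proof (rule pairwiseI)
          fix Z Z' assume ZZ: "Z \<in> P'" "Z' \<in> P'" "Z \<noteq> Z'"
          then consider "Z \<in> P - {X}" "Z' \<in> P - {X}" | "Z \<in> Q" "Z' \<in> Q"
            | "Z \<in> P - {X}" "Z' \<in> Q" | "Z \<in> Q" "Z' \<in> P - {X}"
            unfolding P'_def by blast
          then show "disjnt Z Z'"
          proof cases
            case 1
            then show ?thesis using pairwiseD[OF inside(1)] ZZ(3) by blast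
          next
            case 2
            then show ?thesis using pairwiseD[OF inside(2)] ZZ(3) by blast
          next
            case 3
            then show ?thesis using cross by (simp add: disjnt_def)
          next
            case 4
            then show ?thesis using cross[of Z' Z] by (auto simp: disjnt_def)
          qed
        qed
      qed
      show "\<forall>Z\<in>P'. Z \<subseteq> W - A' \<and> odd (card Z) \<and>
            (\<forall>e\<in>E. e \<subseteq> W \<longrightarrow> e \<inter> Z \<noteq> {} \<longrightarrow> e \<subseteq> Z \<union> A')"
      proof
        fix Z assume "Z \<in> P'"
        then consider "Z \<in> P" "Z \<noteq> X" | "Z \<in> Q" by (auto simp: P'_def)
        then show "Z \<subseteq> W - A' \<and> odd (card Z) \<and>
            (\<forall>e\<in>E. e \<subseteq> W \<longrightarrow> e \<inter> Z \<noteq> {} \<longrightarrow> e \<subseteq> Z \<union> A')"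
        proof cases
          case 1
          then have "Z \<inter> X = {}" using disj X by blast
          then have "Z \<subseteq> W - A'" using PW[OF 1(1)] TY v by (auto simp: A'_def Y_def)
          moreover have "e \<subseteq> Z \<union> A'" if "e \<in> E" "e \<subseteq> W" "e \<inter> Z \<noteq> {}" for e
            using closed[OF 1(1) that] by (auto simp: A'_def)
          ultimately show ?thesis using Podd[OF 1(1)] by blast
        next
          case 2
          have ZY: "Z \<subseteq> Y - T" by (rule QY[OF 2])
          have "Z \<subseteq> W - A'" using ZY XW by (auto simp: A'_def Y_def)
          moreover have "odd (card Z)" using 2 barQ by (auto simp: barrier_def)
          moreover have "e \<subseteq> Z \<union> A'" if e: "e \<in> E" "e \<subseteq> W" "e \<inter> Z \<noteq> {}" for e
          proof -
            have meets: "e \<inter> X \<noteq> {}" using e(3) ZY by (auto simp: Y_def)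
            have sub: "e \<subseteq> X \<union> A" using closed[OF X e(1,2) meets] .
            show ?thesis
            proof (cases "e \<subseteq> Y")
              case True
              then have "e \<subseteq> Z \<union> T" using barrier_closed[OF barQ 2 e(1) _ e(3)] by simp
              then show ?thesis by (auto simp: A'_def)
            next
              case False
              \<comment> \<open>One end of \<open>e\<close> lies in \<open>Z\<close>, the other is \<open>v\<close> or in \<open>A\<close>.\<close>
              then obtain y where y: "y \<in> e" "y \<notin> Y" by blast
              then have yA: "y \<in> A'" using sub by (auto simp: Y_def A'_def)
              obtain z where z: "z \<in> e" "z \<in> Z" using e(3) by blast
              have "z \<noteq> y" using z y ZY by blast
              then have "e = {z, y}" using two e(1) z y
                by (intro card_2_eq_pair) auto
              then show ?thesis using yA z by blast
            qed
          qed
          ultimately show ?thesis by blast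
        qed
      qed
    qed
    moreover have "card A' = card A + (card T + 1)"
    proof -
      have fT: "finite T" using finQ(1) .
      have "v \<notin> T" using TY by (auto simp: Y_def)
      then have "card (insert v T) = card T + 1" using fT by simp
      moreover have "A \<inter> insert v T = {}" using TY XW v by (auto simp: Y_def)
      ultimately show ?thesis using fT finP unfolding A'_def
        by (subst card_Un_disjoint) auto
    qed
    moreover have "card P' + 1 = card P + card Q"
    proof -
      have "(P - {X}) \<inter> Q = {}"
      proof (rule ccontr)
        assume "(P - {X}) \<inter> Q \<noteq> {}"
        then obtain Z where Z: "Z \<in> P" "Z \<noteq> X" "Z \<in> Q" by blast
        then obtain z where "z \<in> Z" using finP(3) by blast
        then show False using Z QY[OF Z(3)] disj[OF Z(1) X] by (auto simp: Y_def)
      qed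
      then have "card P' = card (P - {X}) + card Q"
        unfolding P'_def using finP finQ by (intro card_Un_disjoint) auto
      moreover have "card P = Suc (card (P - {X}))"
        using X finP(2) by (simp only: card_Suc_Diff1)
      ultimately show ?thesis by simp
    qed
    ultimately show False using no_better[of A' P'] excess by linarith
  qed
  moreover have "card B \<le> card {X\<in>P. \<exists>a\<in>B. \<exists>x\<in>X. {a, x} \<in> E}" if B: "B \<subseteq> A" for B
  proof -
    \<comment> \<open>Sets without neighbours in \<open>B\<close> stay closed when \<open>B\<close> is returned to the graph.\<close>
    define NB where "NB = {X\<in>P. \<exists>a\<in>B. \<exists>x\<in>X. {a, x} \<in> E}"
    have "barrier E W (A - B) (P - NB)"
      unfolding barrier_def
    proof (intro conjI)
      show "A - B \<subseteq> W" using AW by blast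
      show "pairwise disjnt (P - NB)" using bar by (auto simp: barrier_def pairwise_def)
      show "\<forall>X\<in>P - NB. X \<subseteq> W - (A - B) \<and> odd (card X) \<and>
            (\<forall>e\<in>E. e \<subseteq> W \<longrightarrow> e \<inter> X \<noteq> {} \<longrightarrow> e \<subseteq> X \<union> (A - B))"
      proof
        fix X assume X: "X \<in> P - NB"
        have "e \<subseteq> X \<union> (A - B)" if e: "e \<in> E" "e \<subseteq> W" "e \<inter> X \<noteq> {}" for e
        proof
          fix y assume y: "y \<in> e"
          have sub: "e \<subseteq> X \<union> A" using closed X e by blast
          obtain x where x: "x \<in> e" "x \<in> X" using e by blast
          show "y \<in> X \<union> (A - B)"
          proof (rule ccontr)
            assume n: "y \<notin> X \<union> (A - B)"
            then have yB: "y \<in> B" using sub y by blast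
            have "x \<noteq> y" using n x by blast
            then have "e = {y, x}" using two e(1) x y
              by (intro card_2_eq_pair) auto
            then show False using X yB x e(1) by (auto simp: NB_def)
          qed
        qed
        then show "X \<subseteq> W - (A - B) \<and> odd (card X) \<and>
            (\<forall>e\<in>E. e \<subseteq> W \<longrightarrow> e \<inter> X \<noteq> {} \<longrightarrow> e \<subseteq> X \<union> (A - B))"
          using X PW Podd by blast
      qed
    qed
    from max_excess[OF this]
    have "int (card (P - NB)) - int (card (A - B)) \<le> int (card P) - int (card A)" .
    moreover have "card (P - NB) = card P - card NB" "card NB \<le> card P"
      using finP by (auto simp: NB_def card_Diff_subset intro: card_mono)
    moreover have "card (A - B) = card A - card B" "card B \<le> card A"
      using finP B by (auto simp: card_Diff_subset finite_subset intro: card_mono)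
    ultimately show ?thesis by (simp add: NB_def)
  qed
  ultimately show ?case using bar cover unfolding critical_barrier_def by blast
qed


section \<open>Boundaries in regular graphs\<close>

definition boundary :: "'a set set \<Rightarrow> 'a set \<Rightarrow> 'a set set" where
  "boundary E X = {e\<in>E. e \<inter> X \<noteq> {} \<and> \<not> e \<subseteq> X}"

text \<open>With \<open>s = card X\<close>, each vertex of \<open>X\<close> has at most \<open>s - 1\<close> neighbours in \<open>X\<close>, hence at least
  \<open>k + 1 - s\<close> boundary edges. If moreover each vertex had at least one, the boundary would have
  at least \<open>s * max 1 (k + 1 - s)\<close> edges, which is at least \<open>k\<close> for every \<open>s \<ge> 1\<close>.\<close>

lemma small_boundary_inner_vertex:
  assumes two: "\<forall>e\<in>E. card e = 2" and finE: "finite E"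
    and X: "finite X" "X \<noteq> {}" and deg: "\<forall>v\<in>X. degree E v = k"
    and small: "card (boundary E X) < k"
  shows "\<exists>v\<in>X. \<forall>e\<in>E. v \<in> e \<longrightarrow> e \<subseteq> X"
proof (rule ccontr)
  assume none: "\<not> ?thesis"
  define s where "s = card X"
  have s: "1 \<le> s" using X by (simp add: s_def Suc_leI card_gt_0_iff)
  define D where "D v = {e\<in>boundary E X. v \<in> e}" for v
  have finD: "finite (D v)" for v using finE by (simp add: D_def boundary_def)
  have lower: "max 1 (k + 1 - s) \<le> card (D v)" if v: "v \<in> X" for v
  proof -
    obtain e where "e \<in> E" "v \<in> e" "\<not> e \<subseteq> X" using none v by blast
    then have "e \<in> D v" using v by (auto simp: D_def boundary_def)
    then have "1 \<le> card (D v)" using finD by (metis One_nat_def Suc_leI card_gt_0_iff empty_iff)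
    moreover have "k \<le> card (D v) + (s - 1)"
    proof -
      define I where "I = {e\<in>E. v \<in> e \<and> e \<subseteq> X}"
      have "I \<subseteq> (\<lambda>x. {v, x}) ` (X - {v})"
      proof
        fix e assume e: "e \<in> I"
        then obtain a b where "e = {a, b}" "a \<noteq> b" using two by (auto simp: I_def card_2_iff)
        then show "e \<in> (\<lambda>x. {v, x}) ` (X - {v})" using e by (auto simp: I_def)
      qed
      then have "card I \<le> card (X - {v})" using X(1) by (meson finite_Diff surj_card_le)
      then have I: "card I \<le> s - 1" using v X by (simp add: s_def)
      have "{e\<in>E. v \<in> e} = D v \<union> I" using v by (auto simp: D_def I_def boundary_def)
      then have "k \<le> card (D v) + card I" using deg v by (metis card_Un_le degree_def)
      then show ?thesis using I by linarith
    qed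
    ultimately show ?thesis using s by linarith
  qed
  have "k \<le> s * max 1 (k + 1 - s)"
  proof (cases "s \<le> k")
    case True
    then obtain t where t: "k = s + t" using le_Suc_ex by blast
    have "s + t \<le> s * (t + 1)" using s by (cases s) auto
    then show ?thesis using t by (simp add: max_def)
  qed auto
  also have "\<dots> = (\<Sum>v\<in>X. max 1 (k + 1 - s))" by (simp add: s_def)
  also have "\<dots> \<le> (\<Sum>v\<in>X. card (D v))" using lower by (rule sum_mono)
  also have "\<dots> = card (\<Union>v\<in>X. D v)"
  proof (rule card_UN_disjoint[symmetric])
    \<comment> \<open>A boundary edge has only one end in \<open>X\<close>.\<close>
    have "v = w" if e: "e \<in> D v" "e \<in> D w" and vw: "v \<in> X" "w \<in> X" for v w e
    proof (rule ccontr)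
      assume "v \<noteq> w"
      moreover have "card e = 2" "v \<in> e" "w \<in> e" using e two by (auto simp: D_def boundary_def)
      ultimately have "e = {v, w}" by (intro card_2_eq_pair) auto
      then show False using e vw by (auto simp: D_def boundary_def)
    qed
    then show "\<forall>i\<in>X. \<forall>j\<in>X. i \<noteq> j \<longrightarrow> D i \<inter> D j = {}" by blast
  qed (use X finD in auto)
  also have "\<dots> \<le> card (boundary E X)"
    using finE by (intro card_mono) (auto simp: D_def boundary_def)
  finally show False using small by simp
qed

text \<open>Double counting of the edges between \<open>\<Union>J\<close> and \<open>A\<close>: each set of \<open>J\<close> sends at least \<open>k\<close> edges,
  each vertex of \<open>A\<close> receives at most \<open>k\<close>.\<close>

lemma large_boundaries_hall:
  assumes two: "\<forall>e\<in>E. card e = 2" and EV: "\<forall>e\<in>E. e \<subseteq> V" and fin: "finite V"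
    and reg: "regular V E k" and k: "k > 0"
    and bar: "barrier E V A P" and J: "J \<subseteq> P" and large: "\<forall>X\<in>J. k \<le> card (boundary E X)"
  shows "card J \<le> card {a\<in>A. \<exists>X\<in>J. \<exists>x\<in>X. {a, x} \<in> E}"
proof -
  define T where "T = {a\<in>A. \<exists>X\<in>J. \<exists>x\<in>X. {a, x} \<in> E}"
  note finP = barrier_finite[OF fin bar]
  have finE: "finite E" using EV fin by (meson PowI finite_Pow_iff finite_subset subsetI)
  have TV: "T \<subseteq> V" using bar by (auto simp: T_def barrier_def)
  have finT: "finite T" using TV fin finite_subset by blast
  have finJ: "finite J" using J finP finite_subset by blast
  have shape: "\<exists>a x. e = {a, x} \<and> a \<in> A \<and> x \<in> X" if X: "X \<in> P" and e: "e \<in> boundary E X" for X e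
  proof -
    have eE: "e \<in> E" "e \<inter> X \<noteq> {}" "\<not> e \<subseteq> X" using e by (auto simp: boundary_def)
    then have "e \<subseteq> X \<union> A" using barrier_closed[OF bar X] EV by simp
    then obtain a x where ax: "a \<in> A" "a \<in> e" "x \<in> X" "x \<in> e" "a \<notin> X" using eE by blast
    then have "a \<noteq> x" by blast
    then have "e = {a, x}" using two eE(1) ax
      by (intro card_2_eq_pair) auto
    then show ?thesis using ax by blast
  qed
  have "k * card J = (\<Sum>X\<in>J. k)" by simp
  also have "\<dots> \<le> (\<Sum>X\<in>J. card (boundary E X))" using large by (intro sum_mono) blast
  also have "\<dots> = card (\<Union>X\<in>J. boundary E X)"
  proof (rule card_UN_disjoint[symmetric])
    show "\<forall>X\<in>J. \<forall>Y\<in>J. X \<noteq> Y \<longrightarrow> boundary E X \<inter> boundary E Y = {}"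
    proof (intro ballI impI, rule ccontr)
      fix X Y assume XY: "X \<in> J" "Y \<in> J" "X \<noteq> Y" "boundary E X \<inter> boundary E Y \<noteq> {}"
      then obtain e where e: "e \<in> boundary E X" "e \<in> boundary E Y" by blast
      then obtain a x where ax: "e = {a, x}" "a \<in> A" "x \<in> X" using shape J XY by blast
      have "e \<inter> Y \<noteq> {}" using e by (simp add: boundary_def)
      moreover have "a \<notin> Y" using ax barrier_subset[OF bar] XY J by blast
      ultimately have "x \<in> Y" using ax by blast
      then show False using barrier_disjoint[OF bar] ax(3) XY(1-3) J by blast
    qed
  qed (use finJ finE in \<open>auto simp: boundary_def\<close>)
  also have "\<dots> \<le> card (\<Union>a\<in>T. {e\<in>E. a \<in> e})"
  proof (rule card_mono)
    show "finite (\<Union>a\<in>T. {e\<in>E. a \<in> e})" using finT finE by auto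
    show "(\<Union>X\<in>J. boundary E X) \<subseteq> (\<Union>a\<in>T. {e\<in>E. a \<in> e})"
    proof
      fix e assume "e \<in> (\<Union>X\<in>J. boundary E X)"
      then obtain X where X: "X \<in> J" "e \<in> boundary E X" by blast
      then obtain a x where ax: "e = {a, x}" "a \<in> A" "x \<in> X" using shape J by blast
      moreover have "e \<in> E" using X by (simp add: boundary_def)
      ultimately show "e \<in> (\<Union>a\<in>T. {e\<in>E. a \<in> e})" using X by (auto simp: T_def)
    qed
  qed
  also have "\<dots> \<le> (\<Sum>a\<in>T. card {e\<in>E. a \<in> e})" by (rule card_UN_le[OF finT])
  also have "\<dots> = (\<Sum>a\<in>T. k)"
    using reg TV by (intro sum.cong) (auto simp: regular_def degree_def)
  also have "\<dots> = k * card T" by simp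
  finally show ?thesis using k by (simp add: T_def)
qed


section \<open>Maximum matchings in regular graphs\<close>

theorem theorem1p2:
  fixes V :: "'a set" and E :: "'a set set" and k :: nat
  assumes "finite_simple_graph V E"
    and "regular V E k"
  shows "\<exists>M. maximum_matching E M \<and>
    \<not> (\<exists>u\<in>V. \<exists>v\<in>V. \<exists>w\<in>V. u \<noteq> v \<and> \<not> saturated M u \<and> \<not> saturated M v \<and>
        adjacent E w u \<and> adjacent E w v)"
proof -
  have fin: "finite V" and two: "\<forall>e\<in>E. card e = 2" and EV: "\<forall>e\<in>E. e \<subseteq> V"
    using assms(1) by (auto simp: finite_simple_graph_def)
  have finE: "finite E" using EV fin by (meson PowI finite_Pow_iff finite_subset subsetI)
  show ?thesis
  proof (cases "k = 0")
    case True
    have "E = {}"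
    proof (rule ccontr)
      assume "E \<noteq> {}"
      then obtain e where e: "e \<in> E" by blast
      then obtain v where v: "v \<in> e" using two by fastforce
      then have "degree E v = 0" using e EV assms(2) True by (auto simp: regular_def)
      then show False using e v finE by (auto simp: degree_def)
    qed
    then show ?thesis
      by (intro exI[of _ "{}"]) (auto simp: maximum_matching_def matching_def adjacent_def)
  next
    case False
    obtain A P where crit: "critical_barrier E V A P"
      using ex_critical_barrier[OF two fin] by blast
    then have bar: "barrier E V A P" by (simp add: critical_barrier_def)
    note finP = barrier_finite[OF fin bar]
    define H where "H = {X\<in>P. k \<le> card (boundary E X)}"
    have "\<forall>X\<in>P. \<exists>v\<in>X. X \<notin> H \<longrightarrow> (\<forall>e\<in>E. v \<in> e \<longrightarrow> e \<subseteq> X)"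
    proof
      fix X assume X: "X \<in> P"
      show "\<exists>v\<in>X. X \<notin> H \<longrightarrow> (\<forall>e\<in>E. v \<in> e \<longrightarrow> e \<subseteq> X)"
      proof (cases "X \<in> H")
        case True
        then show ?thesis using finP(3)[OF X] by blast
      next
        case False
        have "\<forall>v\<in>X. degree E v = k" using assms(2) barrier_subset[OF bar X] by (auto simp: regular_def)
        then show ?thesis
          using small_boundary_inner_vertex[OF two finE] finP(3)[OF X] False X
          by (auto simp: H_def not_le)
      qed
    qed
    then obtain c where c: "\<forall>X\<in>P. c X \<in> X"
      and inner: "\<forall>X\<in>P - H. \<forall>e\<in>E. c X \<in> e \<longrightarrow> e \<subseteq> X" by (metis DiffD1 DiffD2)
    have hallH: "\<forall>J\<subseteq>H. card J \<le> card {a\<in>A. \<exists>X\<in>J. \<exists>x\<in>X. {a, x} \<in> E}"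
      using large_boundaries_hall[OF two EV fin assms(2) _ bar] False by (auto simp: H_def)
    have "H \<subseteq> P" by (auto simp: H_def)
    from critical_barrier_matching[OF fin crit this hallH c]
    obtain M Q where M: "matching E M" "\<Union>M \<subseteq> V" "V - \<Union>M = c ` Q" "Q \<subseteq> P - H"
      "card (V - \<Union>M) + card A = card P" by blast
    have unsat_card: "card (V - \<Union>N) + 2 * card N = card V" "\<Union>N \<subseteq> V" if "matching E N" for N
    proof -
      show sub: "\<Union>N \<subseteq> V" using that EV by (auto simp: matching_def)
      then have "card (V - \<Union>N) + card (\<Union>N) = card V"
        using fin by (metis add.commute card_Diff_subset card_mono finite_subset le_add_diff_inverse)
      then show "card (V - \<Union>N) + 2 * card N = card V"
        using card_Union_matching[OF two that] by simp
    qed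
    have "maximum_matching E M"
      unfolding maximum_matching_def
    proof (intro conjI allI impI)
      fix N assume N: "matching E N"
      have "card P \<le> card A + card (V - \<Union>N)"
        using barrier_bound[OF two fin bar N unsat_card(2)[OF N]] .
      then show "card N \<le> card M" using unsat_card(1)[OF N] unsat_card(1)[OF M(1)] M(5) by linarith
    qed (rule M(1))
    moreover have False if uvw: "u \<in> V" "v \<in> V" "u \<noteq> v" "\<not> saturated M u" "\<not> saturated M v"
      "adjacent E w u" "adjacent E w v" for u v w
    proof -
      have "u \<in> c ` Q" "v \<in> c ` Q" using uvw M(3) by (auto simp: saturated_def)
      then obtain X Y where XY: "X \<in> Q" "u = c X" "Y \<in> Q" "v = c Y" by blast
      have nbr: "w \<in> Z" if "Z \<in> Q" "adjacent E w (c Z)" for Z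
      proof -
        have "Z \<in> P - H" "{w, c Z} \<in> E" using that M(4) by (auto simp: adjacent_def)
        then have "{w, c Z} \<subseteq> Z" using inner by blast
        then show ?thesis by simp
      qed
      have "w \<in> X" "w \<in> Y" using nbr XY uvw(6,7) by simp_all
      moreover have "X \<noteq> Y" using XY uvw(3) by blast
      ultimately show False using barrier_disjoint[OF bar] XY(1,3) M(4) by blast
    qed
    ultimately show ?thesis by blast
  qed
qed

end
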